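(* Let $A$ and $B$ be two families, each consisting of $n$ subsets of a finite universe $C$ with $|C| = O(\log n)$. In $O(n\log n)$ time one can construct a graph $G$ with $O(n)$ vertices and a vertex $u$ of $G$ such that $u$ is non-avoidable in $G$ if and only if there exist $a\in A$ and $b\in B$ with $a\cap b=\emptyset$. In other words, the Orthogonal-Vector problem with $|A|=|B|=n$ can be reduced in $O(n\log n)$ time to the problem of deciding whether a particular vertex of an $O(n)$-vertex graph is avoidable.
   Context: All graphs are finite, simple and undirected. For a graph $G$ and a vertex $v$, $N_G(v)$ is the neighborhood and $N_G[v]=N_G(v)\cup\{v\}$. A $P_3$ is an induced path on three vertices. A vertex $v$ is avoidable if every induced $P_3$ with middle vertex $v$ is contained in an induced cycle of $G$; equivalently, $d_G(v)\le 1$ or for every pair $x,y\in N_G(v)$ the vertices $x$ and $y$ lie in the same connected component of $G-(N_G[v]\setminus\{x,y\})$. The Orthogonal-Vector problem (OV) takes as input two families $A$ and $B$ of $n$ sets over a universe $C$ and asks whether there exist $a\in A$, $b\in B$ with $a\cap b=\emptyset$. *)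

theory Defs
  imports Complex_Main "HOL-Library.Landau_Symbols" "Graph_Theory.Pair_Digraph"
begin

text \<open>
  Finite simple undirected graphs are the \<^locale>\<open>pair_graph\<close>s of the library: an edge
  \<open>{x, y}\<close> is the pair of arcs \<open>(x, y)\<close>, \<open>(y, x)\<close>.
\<close>

definition induced_P3 :: "'a pair_pre_digraph \<Rightarrow> 'a \<Rightarrow> 'a \<Rightarrow> 'a \<Rightarrow> bool" where
  "induced_P3 G x v y \<longleftrightarrow>
     x \<noteq> y \<and> (x, v) \<in> parcs G \<and> (v, y) \<in> parcs G \<and> (x, y) \<notin> parcs G"

definition induced_cycle :: "'a pair_pre_digraph \<Rightarrow> 'a list \<Rightarrow> bool" where
  "induced_cycle G xs \<longleftrightarrow>
     3 \<le> length xs \<and> distinct xs \<and> set xs \<subseteq> pverts G \<and>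
     (\<forall>i < length xs. \<forall>j < length xs.
        (xs ! i, xs ! j) \<in> parcs G \<longleftrightarrow>
          j = (i + 1) mod length xs \<or> i = (j + 1) mod length xs)"

text \<open>
  As the cycle is an induced subgraph, it contains the path as soon as it contains its vertices.
\<close>

definition avoidable :: "'a pair_pre_digraph \<Rightarrow> 'a \<Rightarrow> bool" where
  "avoidable G v \<longleftrightarrow>
     (\<forall>x y. induced_P3 G x v y \<longrightarrow> (\<exists>xs. induced_cycle G xs \<and> {x, v, y} \<subseteq> set xs))"

text \<open>
  Running time is the number of steps of a random access machine with \<open>w\<close>-bit words, a sequential
  read-only input and a sequential write-only output. Registers and memory are the same cells,
  addressed directly by the program or indirectly via the contents of a cell. An instruction whose
  result does not fit into a word has no successor configuration, nor has reading beyond the end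
  of the input: such a computation is stuck and does not count as halting. Subtraction is truncated
  at 0.
\<close>

datatype instr =
    Const nat nat
  | Add nat nat nat
  | Sub nat nat nat
  | Load nat nat
  | Store nat nat
  | Read nat
  | Write nat
  | Jump nat
  | JumpZero nat nat

type_synonym program = "instr list"

text \<open>Program counter, memory, remaining input, output written so far.\<close>

type_synonym config = "nat \<times> (nat \<Rightarrow> nat) \<times> nat list \<times> nat list"

inductive ram_step :: "nat \<Rightarrow> program \<Rightarrow> config \<Rightarrow> config \<Rightarrow> bool"
  for w :: nat and P :: program where
  step_Const: "\<lbrakk>pc < length P; P ! pc = Const r k; k < 2 ^ w\<rbrakk>
    \<Longrightarrow> ram_step w P (pc, m, inp, out) (pc + 1, m(r := k), inp, out)"
| step_Add: "\<lbrakk>pc < length P; P ! pc = Add r p q; m p + m q < 2 ^ w\<rbrakk>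
    \<Longrightarrow> ram_step w P (pc, m, inp, out) (pc + 1, m(r := m p + m q), inp, out)"
| step_Sub: "\<lbrakk>pc < length P; P ! pc = Sub r p q\<rbrakk>
    \<Longrightarrow> ram_step w P (pc, m, inp, out) (pc + 1, m(r := m p - m q), inp, out)"
| step_Load: "\<lbrakk>pc < length P; P ! pc = Load r p\<rbrakk>
    \<Longrightarrow> ram_step w P (pc, m, inp, out) (pc + 1, m(r := m (m p)), inp, out)"
| step_Store: "\<lbrakk>pc < length P; P ! pc = Store r p\<rbrakk>
    \<Longrightarrow> ram_step w P (pc, m, inp, out) (pc + 1, m(m r := m p), inp, out)"
| step_Read: "\<lbrakk>pc < length P; P ! pc = Read r; k < 2 ^ w\<rbrakk>
    \<Longrightarrow> ram_step w P (pc, m, k # inp, out) (pc + 1, m(r := k), inp, out)"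
| step_Write: "\<lbrakk>pc < length P; P ! pc = Write r\<rbrakk>
    \<Longrightarrow> ram_step w P (pc, m, inp, out) (pc + 1, m, inp, out @ [m r])"
| step_Jump: "\<lbrakk>pc < length P; P ! pc = Jump l\<rbrakk>
    \<Longrightarrow> ram_step w P (pc, m, inp, out) (l, m, inp, out)"
| step_JumpZero: "\<lbrakk>pc < length P; P ! pc = JumpZero r l\<rbrakk>
    \<Longrightarrow> ram_step w P (pc, m, inp, out) (if m r = 0 then l else pc + 1, m, inp, out)"

lemma ram_step_deterministic:
  assumes "ram_step w P c c1" and "ram_step w P c c2"
  shows "c1 = c2"
  using assms by (auto elim!: ram_step.cases)

text \<open>The machine halts when the program counter leaves the program.\<close>

definition ram_computes :: "nat \<Rightarrow> program \<Rightarrow> nat list \<Rightarrow> nat \<Rightarrow> nat list \<Rightarrow> bool" where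
  "ram_computes w P input t output \<longleftrightarrow>
     (\<exists>pc m inp. (ram_step w P ^^ t) (0, \<lambda>_. 0, input, []) (pc, m, inp, output) \<and>
                 length P \<le> pc)"

text \<open>
  The families are lists, so that they may contain a set repeatedly. A set is given by its
  characteristic vector with respect to the increasing enumeration of the universe.
\<close>

definition char_vector :: "nat set \<Rightarrow> nat set \<Rightarrow> nat list" where
  "char_vector C a = map (\<lambda>c. if c \<in> a then 1 else 0) (sorted_list_of_set C)"

definition ov_encoding :: "nat set \<Rightarrow> nat set list \<Rightarrow> nat set list \<Rightarrow> nat list" where
  "ov_encoding C A B = length A # card C # concat (map (char_vector C) (A @ B))"

text \<open>
  A graph on the vertices \<open>0, \<dots>, N - 1\<close> with a distinguished vertex \<open>u\<close> is output as \<open>N\<close>,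
  \<open>u\<close> and a list of the edges, in which every edge occurs exactly once, in one of its orientations.
\<close>

definition graph_encoding :: "nat pair_pre_digraph \<Rightarrow> nat \<Rightarrow> nat list \<Rightarrow> bool" where
  "graph_encoding G u out \<longleftrightarrow>
     pverts G = {..<card (pverts G)} \<and>
     (\<exists>es. out = card (pverts G) # u # concat (map (\<lambda>(x, y). [x, y]) es) \<and>
           distinct (map (\<lambda>(x, y). {x, y}) es) \<and>
           parcs G = set es \<union> (set es)\<inverse>)"

end

theory Submission
  imports Defs "HOL-Real_Asymp.Real_Asymp"
begin

text \<open>
  The neighbours of \<open>u\<close> are one vertex for every set of the two families. The remaining vertices are
  the elements of the universe, each adjacent to the sets containing it, and two hubs, one adjacent
  to all of \<open>A\<close> and one to all of \<open>B\<close>. An induced cycle through \<open>x\<close>, \<open>u\<close>, \<open>y\<close> avoids all other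
  neighbours of \<open>u\<close>, and as the sets form one side of a bipartition, it has to return from \<open>x\<close> to
  \<open>y\<close> through a single common neighbour. Two sets of the same family have their hub in common; a set
  of \<open>A\<close> and a set of \<open>B\<close> have a common neighbour besides \<open>u\<close> iff they intersect. The graph has
  \<open>2 n + |C| + 3\<close> vertices and its edges can be written while reading the input once.
\<close>

section \<open>Avoidability and common neighbours\<close>

text \<open>Among the vertices of an induced cycle only consecutive ones are joined, so the
  neighbours of \<open>v\<close> are its cyclic successor and predecessor; length at least 3 keeps
  them apart.\<close>

lemma induced_cycle_two_neighbours:
  assumes "induced_cycle G xs" and "v \<in> set xs"
  obtains p q where "p \<noteq> q" and "\<And>w. w \<in> set xs \<and> (v, w) \<in> parcs G \<longleftrightarrow> w = p \<or> w = q"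
proof -
  let ?L = "length xs"
  have L: "3 \<le> ?L" and dist: "distinct xs"
    and arc: "\<And>i j. i < ?L \<Longrightarrow> j < ?L \<Longrightarrow>
      (xs ! i, xs ! j) \<in> parcs G \<longleftrightarrow> j = (i + 1) mod ?L \<or> i = (j + 1) mod ?L"
    using assms(1) by (auto simp: induced_cycle_def)
  obtain i where i: "i < ?L" "v = xs ! i"
    using assms(2) by (auto simp: in_set_conv_nth)
  define s where "s = (i + 1) mod ?L"
  define p where "p = (if i = 0 then ?L - 1 else i - 1)"
  have s_eq: "s = (if i = ?L - 1 then 0 else i + 1)"
    using i by (cases ?L) (auto simp: s_def)
  have lt: "s < ?L" "p < ?L" and ne: "s \<noteq> p"
    using i L by (auto simp: s_eq p_def)
  \<comment> \<open>Solves the successor equation for \<open>j\<close>; only the last index wraps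
    around to 0.\<close>
  have pred: "i = (j + 1) mod ?L \<longleftrightarrow> j = p" if "j < ?L" for j
  proof (cases "j = ?L - 1")
    case True
    then have "(j + 1) mod ?L = 0" using L by (cases ?L) auto
    then show ?thesis using i True by (auto simp: p_def)
  next
    case False
    then have "(j + 1) mod ?L = j + 1" using that by simp
    then show ?thesis using i False by (auto simp: p_def)
  qed
  have "w \<in> set xs \<and> (v, w) \<in> parcs G \<longleftrightarrow> w = xs ! s \<or> w = xs ! p" for w
    using arc[OF i(1)] pred lt i(2) by (auto simp: in_set_conv_nth s_def)
  moreover have "xs ! s \<noteq> xs ! p"
    using dist lt ne by (simp add: nth_eq_iff_index_eq)
  ultimately show thesis using that by blast
qed

lemma induced_cycle_of_length_4:
  assumes "distinct [a, b, c, d]" and "{a, b, c, d} \<subseteq> pverts G" and "sym (parcs G)"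
    and "\<And>x. (x, x) \<notin> parcs G"
    and "(a, b) \<in> parcs G" "(b, c) \<in> parcs G" "(c, d) \<in> parcs G" "(d, a) \<in> parcs G"
    and "(a, c) \<notin> parcs G" "(b, d) \<notin> parcs G"
  shows "induced_cycle G [a, b, c, d]"
proof -
  have "(b, a) \<in> parcs G" "(c, b) \<in> parcs G" "(d, c) \<in> parcs G" "(a, d) \<in> parcs G"
    "(c, a) \<notin> parcs G" "(d, b) \<notin> parcs G"
    using assms by (meson symD)+
  moreover have "(\<forall>i < 4. Q i) \<longleftrightarrow> Q 0 \<and> Q 1 \<and> Q 2 \<and> Q 3" for Q :: "nat \<Rightarrow> bool"
    by (auto simp: eval_nat_numeral less_Suc_eq)
  moreover have "length [a, b, c, d] = 4" by simp
  ultimately show ?thesis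
    using assms unfolding induced_cycle_def by (simp del: list.size)
qed

text \<open>\<open>S\<close> holds each edge once, oriented towards \<open>X\<close>. As
  \<open>X\<close> is the independent neighbourhood of \<open>u\<close>, any two of its members form
  an induced P3 with \<open>u\<close>, and it remains to see which of these close up to an induced
  cycle.\<close>

lemma avoidable_iff_common_neighbour:
  assumes parcs: "parcs G = S \<union> S\<inverse>"
    and S: "{u} \<times> X \<subseteq> S" "S \<subseteq> insert u Z \<times> X"
    and disj: "u \<notin> X" "u \<notin> Z" "X \<inter> Z = {}"
    and verts: "insert u (X \<union> Z) \<subseteq> pverts G"
  shows "avoidable G u \<longleftrightarrow>
    (\<forall>x\<in>X. \<forall>y\<in>X. x \<noteq> y \<longrightarrow> (\<exists>z\<in>Z. (z, x) \<in> S \<and> (z, y) \<in> S))"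
proof -
  have sym: "sym (parcs G)" by (auto simp: parcs sym_def)
  have u_arc: "(u, w) \<in> parcs G \<longleftrightarrow> w \<in> X" for w
    using S disj by (auto simp: parcs)
  have arc_u: "(w, u) \<in> parcs G \<longleftrightarrow> w \<in> X" for w
    using S disj by (auto simp: parcs)
  have X_arc: "(x, w) \<in> parcs G \<longleftrightarrow> w \<in> insert u Z \<and> (w, x) \<in> S" if "x \<in> X" for x w
    using S disj that by (auto simp: parcs)
  have Z_arc: "(z, w) \<in> parcs G \<longleftrightarrow> w \<in> X \<and> (z, w) \<in> S" if "z \<in> Z" for z w
    using S disj that by (auto simp: parcs)
  have P3: "induced_P3 G x u y \<longleftrightarrow> x \<in> X \<and> y \<in> X \<and> x \<noteq> y" for x y
    using u_arc X_arc disj S arc_u by (auto simp: induced_P3_def)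
  have "(\<exists>xs. induced_cycle G xs \<and> {x, u, y} \<subseteq> set xs) \<longleftrightarrow>
    (\<exists>z\<in>Z. (z, x) \<in> S \<and> (z, y) \<in> S)" if xy: "x \<in> X" "y \<in> X" "x \<noteq> y" for x y
  proof
    assume "\<exists>z\<in>Z. (z, x) \<in> S \<and> (z, y) \<in> S"
    then obtain z where z: "z \<in> Z" "(z, x) \<in> S" "(z, y) \<in> S" by blast
    have loop: "(w, w) \<notin> parcs G" for w using S disj by (auto simp: parcs)
    \<comment> \<open>Opposite corners lie on the same side of the bipartition, so there are no
      chords.\<close>
    have "induced_cycle G [u, x, z, y]"
      using xy z disj verts S
      by (intro induced_cycle_of_length_4 sym loop) (auto simp: parcs)
    then show "\<exists>xs. induced_cycle G xs \<and> {x, u, y} \<subseteq> set xs" by fastforce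
  next
    assume "\<exists>xs. induced_cycle G xs \<and> {x, u, y} \<subseteq> set xs"
    then obtain xs where xs: "induced_cycle G xs" and sub: "x \<in> set xs" "u \<in> set xs" "y \<in> set xs"
      by blast
    \<comment> \<open>On the cycle \<open>u\<close> has exactly two neighbours, and \<open>x\<close>
      and \<open>y\<close> are already two.\<close>
    have u_nbrs: "w = x \<or> w = y" if w: "w \<in> set xs" "w \<in> X" for w
    proof -
      obtain p q where "\<And>w. w \<in> set xs \<and> (u, w) \<in> parcs G \<longleftrightarrow> w = p \<or> w = q"
        using induced_cycle_two_neighbours[OF xs sub(2)] by metis
      then show ?thesis using w xy sub unfolding u_arc by metis
    qed
    obtain z where z: "z \<noteq> u" "z \<in> set xs" "(x, z) \<in> parcs G"
      using induced_cycle_two_neighbours[OF xs sub(1)] by metis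
    then have zZ: "z \<in> Z" "(z, x) \<in> S" using X_arc xy by auto
    \<comment> \<open>The second cycle neighbour of \<open>z\<close> lies in \<open>X\<close>, so it
      is adjacent to \<open>u\<close> and can only be \<open>y\<close>.\<close>
    obtain w where w: "w \<noteq> x" "w \<in> set xs" "(z, w) \<in> parcs G"
      using induced_cycle_two_neighbours[OF xs z(2)] by metis
    then have "w = y" using u_nbrs Z_arc zZ by blast
    then show "\<exists>z\<in>Z. (z, x) \<in> S \<and> (z, y) \<in> S" using w zZ Z_arc by blast
  qed
  then show ?thesis by (auto simp: avoidable_def P3)
qed

section \<open>The edge list\<close>

text \<open>The recursion follows the order in which the program writes; \<open>v\<close> is the
  vertex of the set and \<open>c\<close> that of the element whose bit comes next.\<close>

fun bit_edges :: "nat \<Rightarrow> nat \<Rightarrow> nat list \<Rightarrow> (nat \<times> nat) list" where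
  "bit_edges v c [] = []"
| "bit_edges v c (b # bs) = (if b = 0 then [] else [(c, v)]) @ bit_edges v (Suc c) bs"

fun row_edges :: "nat \<Rightarrow> nat \<Rightarrow> nat list list \<Rightarrow> (nat \<times> nat) list" where
  "row_edges mid v [] = []"
| "row_edges mid v (r # rs) =
     (0, v) # (if v < mid then 1 else 2, v) # bit_edges v 3 r @ row_edges mid (Suc v) rs"

lemma ex_nat_iff: "(\<exists>i. Q i) \<longleftrightarrow> Q 0 \<or> (\<exists>i. Q (Suc i))" for Q :: "nat \<Rightarrow> bool"
  by (metis not0_implies_Suc)

lemma set_bit_edges:
  "set (bit_edges v c bs) = {(c + i, v) | i. i < length bs \<and> bs ! i \<noteq> 0}"
proof (induction bs arbitrary: c)
  case (Cons b bs)
  have "(\<exists>i. x = c + i \<and> i < Suc (length bs) \<and> (b # bs) ! i \<noteq> 0) \<longleftrightarrow>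
    x = c \<and> b \<noteq> 0 \<or> (\<exists>i. x = Suc c + i \<and> i < length bs \<and> bs ! i \<noteq> 0)" for x
    by (subst ex_nat_iff) auto
  then show ?case using Cons.IH[of "Suc c"] by auto
qed simp

lemma mem_row_edges_iff:
  "(x, y) \<in> set (row_edges mid v rs) \<longleftrightarrow>
    (\<exists>j < length rs. y = v + j \<and>
      (x = 0 \<or> x = (if v + j < mid then 1 else 2) \<or>
       (\<exists>i < length (rs ! j). x = 3 + i \<and> rs ! j ! i \<noteq> 0)))"
proof (induction rs arbitrary: v)
  case (Cons r rs)
  show ?case
    by (subst ex_nat_iff) (auto simp: Cons.IH set_bit_edges)
qed simp

lemma distinct_bit_edges: "distinct (bit_edges v c bs)"
  by (induction bs arbitrary: c) (auto simp: set_bit_edges)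

text \<open>Edges of different rows differ in the second component; within a row the first
  components are 0, a hub below 3, and elements from 3 on.\<close>

lemma distinct_row_edges: "distinct (row_edges mid v rs)"
  by (induction rs arbitrary: v) (auto simp: distinct_bit_edges set_bit_edges mem_row_edges_iff)

section \<open>The graph of an orthogonal vectors instance\<close>

text \<open>
  Vertex \<open>0\<close> is \<open>u\<close>, \<open>1\<close> and \<open>2\<close> are the hubs of \<open>A\<close> and \<open>B\<close>, then follow the elements of the
  universe and, from \<open>3 + card C\<close> on, the sets of \<open>A @ B\<close>.
\<close>

definition ov_rows :: "nat set \<Rightarrow> nat set list \<Rightarrow> nat set list \<Rightarrow> nat list list" where
  "ov_rows C A B = map (char_vector C) (A @ B)"

definition ov_edges :: "nat set \<Rightarrow> nat set list \<Rightarrow> nat set list \<Rightarrow> (nat \<times> nat) list" where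
  "ov_edges C A B = row_edges (3 + card C + length A) (3 + card C) (ov_rows C A B)"

definition ov_graph :: "nat set \<Rightarrow> nat set list \<Rightarrow> nat set list \<Rightarrow> nat pair_pre_digraph" where
  "ov_graph C A B =
     \<lparr>pverts = {..<3 + card C + length (A @ B)},
      parcs = set (ov_edges C A B) \<union> (set (ov_edges C A B))\<inverse>\<rparr>"

lemma mem_ov_edges_iff:
  "(x, y) \<in> set (ov_edges C A B) \<longleftrightarrow>
    (\<exists>j < length (A @ B). y = 3 + card C + j \<and>
      (x = 0 \<or> x = (if j < length A then 1 else 2) \<or>
       (\<exists>i < card C. x = 3 + i \<and> sorted_list_of_set C ! i \<in> (A @ B) ! j)))"
proof -
  have row: "ov_rows C A B ! j = char_vector C ((A @ B) ! j)" if "j < length (A @ B)" for j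
    using that unfolding ov_rows_def by (rule nth_map)
  have len: "length (ov_rows C A B) = length (A @ B)"
    by (simp add: ov_rows_def)
  show ?thesis
    unfolding ov_edges_def mem_row_edges_iff len
    \<comment> \<open>The congruence rule supplies the bound on \<open>j\<close> under which
      \<open>row\<close> applies.\<close>
    by (rule ex_cong1, rule conj_cong[OF refl])
      (auto simp: row char_vector_def simp del: length_append)
qed

text \<open>The threshold \<open>3 + card C\<close> separates the sets from all other vertices. This
  rules out loops and lets an unordered edge determine its orientation.\<close>

lemma ov_edges_bipartite:
  "set (ov_edges C A B) \<subseteq> {..<3 + card C} \<times> {3 + card C..<3 + card C + length (A @ B)}"
  by (auto simp: mem_ov_edges_iff split: if_splits)

lemma pair_graph_ov_graph: "pair_graph (ov_graph C A B)"
proof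
  have fin: "finite (set (ov_edges C A B))" by simp
  then show "finite (parcs (ov_graph C A B))"
    unfolding ov_graph_def by simp
  show "symmetric (ov_graph C A B)"
    by (auto simp: ov_graph_def symmetric_def sym_def)
qed (use ov_edges_bipartite[of C A B] in \<open>force simp: ov_graph_def\<close>)+

lemma graph_encoding_ov_graph:
  "graph_encoding (ov_graph C A B) 0
    ((3 + card C + length (A @ B)) # 0 # concat (map (\<lambda>(x, y). [x, y]) (ov_edges C A B)))"
proof -
  have "inj_on (\<lambda>(x, y). {x, y}) (set (ov_edges C A B))"
  proof (intro inj_onI, clarify)
    fix x y x' y'
    assume "(x, y) \<in> set (ov_edges C A B)" "(x', y') \<in> set (ov_edges C A B)"
      and "{x, y} = {x', y'}"
    then show "x = x' \<and> y = y'"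
      using subsetD[OF ov_edges_bipartite, of "(x, y)" C A B]
        subsetD[OF ov_edges_bipartite, of "(x', y')" C A B]
      by (auto simp: doubleton_eq_iff)
  qed
  then have "distinct (map (\<lambda>(x, y). {x, y}) (ov_edges C A B))"
    by (simp add: distinct_map ov_edges_def distinct_row_edges)
  then show ?thesis
    unfolding graph_encoding_def by (auto simp: ov_graph_def)
qed

text \<open>The range of \<open>z\<close> starts at 1 to leave out \<open>u\<close>, which is
  adjacent to every set. A common neighbour below 3 is a hub and shows that the families agree; one
  from 3 on is a shared element.\<close>

lemma ov_edges_common_neighbour_iff:
  assumes "finite C" and "\<And>s. s \<in> set (A @ B) \<Longrightarrow> s \<subseteq> C"
    and "i < length (A @ B)" and "j < length (A @ B)"
  shows "(\<exists>z \<in> {1..<3 + card C}. (z, 3 + card C + i) \<in> set (ov_edges C A B) \<and>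
      (z, 3 + card C + j) \<in> set (ov_edges C A B)) \<longleftrightarrow>
    (i < length A \<longleftrightarrow> j < length A) \<or> (A @ B) ! i \<inter> (A @ B) ! j \<noteq> {}"
    (is "?L \<longleftrightarrow> ?R")
proof -
  have adj: "(z, 3 + card C + l) \<in> set (ov_edges C A B) \<longleftrightarrow>
      z = 0 \<or> z = (if l < length A then 1 else 2) \<or>
       (\<exists>i < card C. z = 3 + i \<and> sorted_list_of_set C ! i \<in> (A @ B) ! l)"
    if "l < length (A @ B)" for z l
    using that unfolding mem_ov_edges_iff add_left_cancel by blast
  show ?thesis
  proof
    assume ?L
    then obtain z where "1 \<le> z" and z: "(z, 3 + card C + i) \<in> set (ov_edges C A B)"
      "(z, 3 + card C + j) \<in> set (ov_edges C A B)"
      by auto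
    show ?R
    proof (cases "z < 3")
      case True
      then have "z = (if i < length A then 1 else 2)" "z = (if j < length A then 1 else 2)"
        using z \<open>1 \<le> z\<close> unfolding adj[OF assms(3)] adj[OF assms(4)] by linarith+
      then have "i < length A \<longleftrightarrow> j < length A" by presburger
      then show ?thesis by blast
    next
      case False
      then have "sorted_list_of_set C ! (z - 3) \<in> (A @ B) ! i \<inter> (A @ B) ! j"
        using z unfolding adj[OF assms(3)] adj[OF assms(4)] by (auto split: if_splits)
      then show ?thesis by blast
    qed
  next
    assume ?R
    then show ?L
    proof
      assume "i < length A \<longleftrightarrow> j < length A"
      then show ?L
        unfolding adj[OF assms(3)] adj[OF assms(4)]
        by (intro bexI[of _ "if i < length A then 1 else 2"]) auto
    next
      assume "(A @ B) ! i \<inter> (A @ B) ! j \<noteq> {}"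
      then obtain c where c: "c \<in> (A @ B) ! i" "c \<in> (A @ B) ! j" by blast
      then have "c \<in> set (sorted_list_of_set C)"
        using assms(1) assms(2)[OF nth_mem[OF assms(3)]] by auto
      then obtain l where "l < card C" "c = sorted_list_of_set C ! l"
        by (auto simp: in_set_conv_nth)
      with c show ?L
        unfolding adj[OF assms(3)] adj[OF assms(4)]
        by (intro bexI[of _ "3 + l"]) auto
    qed
  qed
qed

lemma not_avoidable_ov_graph_iff:
  assumes "finite C" and "\<And>s. s \<in> set (A @ B) \<Longrightarrow> s \<subseteq> C"
  shows "\<not> avoidable (ov_graph C A B) 0 \<longleftrightarrow> (\<exists>a \<in> set A. \<exists>b \<in> set B. a \<inter> b = {})"
proof -
  let ?S = "set (ov_edges C A B)" and ?k = "3 + card C"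
  \<comment> \<open>Set vertices are shifted list positions, so repeated sets stay distinct
    vertices.\<close>
  let ?Z = "{1..<?k}" and ?X = "(+) ?k ` {..<length (A @ B)}"
  have "avoidable (ov_graph C A B) 0 \<longleftrightarrow>
    (\<forall>x\<in>?X. \<forall>y\<in>?X. x \<noteq> y \<longrightarrow> (\<exists>z\<in>?Z. (z, x) \<in> ?S \<and> (z, y) \<in> ?S))"
  proof (rule avoidable_iff_common_neighbour)
    show "{0} \<times> ?X \<subseteq> ?S" by (auto simp: mem_ov_edges_iff)
    show "?S \<subseteq> insert 0 ?Z \<times> ?X" by (auto simp: mem_ov_edges_iff split: if_splits)
  qed (auto simp: ov_graph_def)
  also have "\<dots> \<longleftrightarrow> (\<forall>i < length (A @ B). \<forall>j < length (A @ B). i \<noteq> j \<longrightarrow>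
      (i < length A \<longleftrightarrow> j < length A) \<or> (A @ B) ! i \<inter> (A @ B) ! j \<noteq> {})"
    using ov_edges_common_neighbour_iff[of C A B, OF assms]
    by (simp add: Ball_def[of "{..<_}"] del: length_append One_nat_def bex_simps)
  \<comment> \<open>Pairs within a family are settled by their hub. Mixed pairs remain in both
    orders, which agree by symmetry of intersection.\<close>
  also have "\<dots> \<longleftrightarrow> (\<forall>i < length A. \<forall>j < length B. A ! i \<inter> B ! j \<noteq> {})" (is "?L \<longleftrightarrow> ?R")
  proof
    assume L: ?L
    show ?R
    proof (intro allI impI)
      fix i j assume "i < length A" "j < length B"
      then show "A ! i \<inter> B ! j \<noteq> {}"
        using L[rule_format, of i "length A + j"] by (simp add: nth_append)
    qed
  next
    assume ?R
    then have R: "(A @ B) ! i \<inter> (A @ B) ! j \<noteq> {}"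
      if "i < length A" "\<not> j < length A" "j < length (A @ B)" for i j
      using that by (simp add: nth_append)
    show ?L
      using R by (metis Int_commute)
  qed
  also have "\<dots> \<longleftrightarrow> (\<forall>a \<in> set A. \<forall>b \<in> set B. a \<inter> b \<noteq> {})"
    by (simp only: all_set_conv_all_nth)
  finally show ?thesis by blast
qed

section \<open>The program\<close>

text \<open>A functional form of \<open>ram_step\<close>, so that simplification can evaluate
  stretches of a concrete program; \<open>None\<close> means stuck.\<close>

fun exec_instr :: "nat \<Rightarrow> instr \<Rightarrow> config \<Rightarrow> config option" where
  "exec_instr w (Const r k) (pc, m, inp, out) =
     (if k < 2 ^ w then Some (pc + 1, m(r := k), inp, out) else None)"
| "exec_instr w (Add r p q) (pc, m, inp, out) =
     (if m p + m q < 2 ^ w then Some (pc + 1, m(r := m p + m q), inp, out) else None)"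
| "exec_instr w (Sub r p q) (pc, m, inp, out) = Some (pc + 1, m(r := m p - m q), inp, out)"
| "exec_instr w (Load r p) (pc, m, inp, out) = Some (pc + 1, m(r := m (m p)), inp, out)"
| "exec_instr w (Store r p) (pc, m, inp, out) = Some (pc + 1, m(m r := m p), inp, out)"
| "exec_instr w (Read r) (pc, m, inp, out) =
     (case inp of [] \<Rightarrow> None
      | k # inp' \<Rightarrow> if k < 2 ^ w then Some (pc + 1, m(r := k), inp', out) else None)"
| "exec_instr w (Write r) (pc, m, inp, out) = Some (pc + 1, m, inp, out @ [m r])"
| "exec_instr w (Jump l) (pc, m, inp, out) = Some (l, m, inp, out)"
| "exec_instr w (JumpZero r l) (pc, m, inp, out) =
     Some (if m r = 0 then l else pc + 1, m, inp, out)"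

fun run :: "nat \<Rightarrow> program \<Rightarrow> nat \<Rightarrow> config \<Rightarrow> config option" where
  "run w P 0 c = Some c"
| "run w P (Suc t) c =
     (if fst c < length P then Option.bind (exec_instr w (P ! fst c) c) (run w P t) else None)"

lemma run_numeral:
  "run w P (numeral k) c =
     (if fst c < length P then Option.bind (exec_instr w (P ! fst c) c) (run w P (pred_numeral k))
      else None)"
  by (simp add: numeral_eq_Suc)

lemma ram_step_exec_instr:
  assumes "pc < length P" and "exec_instr w (P ! pc) (pc, m, inp, out) = Some c'"
  shows "ram_step w P (pc, m, inp, out) c'"
proof (cases "P ! pc")
  case (JumpZero r l)
  then show ?thesis using assms step_JumpZero[of pc P r l w m inp out] by simp
qed (use assms in \<open>auto intro: ram_step.intros[simplified] split: if_splits list.splits\<close>)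

lemma relpowp_run: "run w P t c = Some c' \<Longrightarrow> (ram_step w P ^^ t) c c'"
proof (induction t arbitrary: c)
  case (Suc t)
  obtain pc m inp out where c: "c = (pc, m, inp, out)" by (cases c) auto
  from Suc.prems obtain c1 where "pc < length P" "exec_instr w (P ! pc) c = Some c1"
    "run w P t c1 = Some c'"
    by (auto simp: c bind_eq_Some_conv split: if_splits)
  then show ?case
    using ram_step_exec_instr Suc.IH c by (metis relpowp_Suc_I2)
qed simp

text \<open>An upper bound rather than an exact count, because the branches of the loops differ in
  length; such bounds add up under composition.\<close>

definition reaches :: "nat \<Rightarrow> program \<Rightarrow> config \<Rightarrow> nat \<Rightarrow> config \<Rightarrow> bool" where
  "reaches w P c t c' \<longleftrightarrow> (\<exists>s \<le> t. (ram_step w P ^^ s) c c')"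

lemma reaches_run: "run w P s c = Some c' \<Longrightarrow> s \<le> t \<Longrightarrow> reaches w P c t c'"
  using relpowp_run unfolding reaches_def by blast

lemma reaches_trans:
  assumes "reaches w P c s c'" and "reaches w P c' t c''" and "s + t \<le> r"
  shows "reaches w P c r c''"
  using assms unfolding reaches_def by (meson add_mono order_trans relpowp_trans)

text \<open>
  Cells \<open>0\<close>, \<open>1\<close>, \<open>2\<close> hold their own address, \<open>3\<close> the first vertex of \<open>A\<close>, \<open>5\<close> the first vertex of
  \<open>B\<close>, \<open>4\<close> the number of vertices, \<open>6\<close> the current set, \<open>7\<close> the current element, and \<open>8\<close> is
  scratch. The loop over the sets starts at \<open>11\<close>, the loop over the elements at \<open>22\<close>.
\<close>

definition ov_program :: program where
  "ov_program =
    [Const 1 1, Const 2 2, Const 3 3, Read 4, Read 5,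
     Add 3 3 5, Add 6 3 0, Add 5 3 4, Add 4 5 4, Write 4, Write 0,
     Sub 8 4 6, JumpZero 8 32,
     Write 0, Write 6,
     Sub 8 5 6, JumpZero 8 19, Write 1, Jump 20, Write 2, Write 6,
     Const 7 3,
     Sub 8 3 7, JumpZero 8 30,
     Read 8, JumpZero 8 28, Write 7, Write 6,
     Add 7 7 1, Jump 22,
     Add 6 6 1, Jump 11]"

abbreviation flatten_pairs :: "('a \<times> 'a) list \<Rightarrow> 'a list" where
  "flatten_pairs es \<equiv> concat (map (\<lambda>(x, y). [x, y]) es)"

text \<open>Invariant of the inner loop: cell 3 marks the end of the element vertices. A bit takes
  at most 8 steps, the final test 2. Only cells 7 and 8 change, which preserves the data of the
  outer loop.\<close>

lemma ov_program_bits: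
  assumes "m 1 = 1" "m 3 = c + length bs" "m 6 = v" "m 7 = c"
    and "m 3 < 2 ^ w" and "\<forall>b \<in> set bs. b < 2 ^ w"
  shows "\<exists>m'. reaches w ov_program (22, m, bs @ inp, out) (8 * length bs + 2)
      (30, m', inp, out @ flatten_pairs (bit_edges v c bs)) \<and> (\<forall>r < 7. m' r = m r)"
  using assms
proof (induction bs arbitrary: m c out)
  case Nil
  then have "run w ov_program 2 (22, m, [] @ inp, out) =
      Some (30, m(8 := 0), inp, out @ flatten_pairs (bit_edges v c []))"
    by (simp add: run_numeral ov_program_def)
  then have "reaches w ov_program (22, m, [] @ inp, out) (8 * length [] + 2)
      (30, m(8 := 0), inp, out @ flatten_pairs (bit_edges v c []))"
    by (rule reaches_run) simp
  moreover have "\<forall>r < 7. (m(8 := 0)) r = m r" by simp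
  ultimately show ?case by blast
next
  case (Cons b bs)
  let ?m = "m(8 := b, 7 := Suc c)"
  have step: "reaches w ov_program (22, m, (b # bs) @ inp, out) 8
      (22, ?m, bs @ inp, out @ (if b = 0 then [] else [c, v]))"
  proof (cases "b = 0")
    case True
    \<comment> \<open>A zero bit skips the two writes, hence 6 steps instead of 8.\<close>
    have "run w ov_program 6 (22, m, (b # bs) @ inp, out) = Some (22, ?m, bs @ inp, out)"
      using Cons.prems True by (simp add: run_numeral ov_program_def)
    then show ?thesis using True by (auto intro: reaches_run)
  next
    case False
    have "run w ov_program 8 (22, m, (b # bs) @ inp, out) = Some (22, ?m, bs @ inp, out @ [c, v])"
      using Cons.prems False by (simp add: run_numeral ov_program_def)
    then show ?thesis using False by (auto intro: reaches_run)
  qed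
  have "\<exists>m'. reaches w ov_program
      (22, ?m, bs @ inp, out @ (if b = 0 then [] else [c, v])) (8 * length bs + 2)
      (30, m', inp, (out @ (if b = 0 then [] else [c, v])) @ flatten_pairs (bit_edges v (Suc c) bs))
      \<and> (\<forall>r < 7. m' r = ?m r)"
    using Cons.prems by (intro Cons.IH) auto
  then obtain m' where tail: "reaches w ov_program
      (22, ?m, bs @ inp, out @ (if b = 0 then [] else [c, v])) (8 * length bs + 2)
      (30, m', inp, (out @ (if b = 0 then [] else [c, v])) @ flatten_pairs (bit_edges v (Suc c) bs))"
    and m': "\<forall>r < 7. m' r = ?m r"
    by blast
  from reaches_trans[OF step tail order_refl]
  have "reaches w ov_program (22, m, (b # bs) @ inp, out) (8 + (8 * length bs + 2))
      (30, m', inp, (out @ (if b = 0 then [] else [c, v])) @ flatten_pairs (bit_edges v (Suc c) bs))" .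
  then have "reaches w ov_program (22, m, (b # bs) @ inp, out) (8 * length (b # bs) + 2)
      (30, m', inp, out @ flatten_pairs (bit_edges v c (b # bs)))"
    by (cases "b = 0") simp_all
  moreover have "\<forall>r < 7. m' r = m r" using m' by simp
  ultimately show ?case by blast
qed

text \<open>A row costs at most 10 steps before the inner loop, \<open>8 * k + 2\<close> inside it
  and 2 to move on. Cell 4 is one past the last set vertex, so its difference to cell 6 counts the
  rows left.\<close>

lemma ov_program_rows:
  assumes "m 0 = 0" "m 1 = 1" "m 2 = 2" "m 3 = 3 + k" "m 4 = v + length rs" "m 5 = mid" "m 6 = v"
    and "m 3 < 2 ^ w" "m 4 < 2 ^ w"
    and "\<forall>r \<in> set rs. length r = k \<and> (\<forall>b \<in> set r. b < 2 ^ w)"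
  shows "\<exists>m'. reaches w ov_program (11, m, concat rs @ inp, out) (length rs * (8 * k + 14) + 2)
      (32, m', inp, out @ flatten_pairs (row_edges mid v rs))"
  using assms
proof (induction rs arbitrary: m v out)
  case Nil
  then have "run w ov_program 2 (11, m, concat [] @ inp, out) = Some (32, m(8 := 0), inp, out)"
    by (simp add: run_numeral ov_program_def)
  then show ?case
    by (auto intro!: exI[of _ "m(8 := 0)"] reaches_run)
next
  case (Cons r rs)
  let ?hub = "if v < mid then 1 else 2"
  \<comment> \<open>The truncated difference in cell 8 is 0 exactly when \<open>mid \<le> v\<close>;
    testing it selects the hub.\<close>
  let ?m = "m(8 := mid - v, 7 := 3)"
  let ?out = "out @ [0, v, ?hub, v]"
  have start: "reaches w ov_program (11, m, concat (r # rs) @ inp, out) 10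
      (22, ?m, r @ concat rs @ inp, ?out)"
  proof (cases "v < mid")
    case True
    have "run w ov_program 10 (11, m, concat (r # rs) @ inp, out) =
        Some (22, ?m, r @ concat rs @ inp, ?out)"
      using Cons.prems True by (simp add: run_numeral ov_program_def)
    then show ?thesis by (auto intro: reaches_run)
  next
    case False
    have "run w ov_program 9 (11, m, concat (r # rs) @ inp, out) =
        Some (22, ?m, r @ concat rs @ inp, ?out)"
      using Cons.prems False by (simp add: run_numeral ov_program_def)
    then show ?thesis by (auto intro: reaches_run)
  qed
  have "\<exists>m'. reaches w ov_program (22, ?m, r @ concat rs @ inp, ?out) (8 * length r + 2)
      (30, m', concat rs @ inp, ?out @ flatten_pairs (bit_edges v 3 r)) \<and> (\<forall>r < 7. m' r = ?m r)"
    using Cons.prems by (intro ov_program_bits) auto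
  then obtain m1 where bits: "reaches w ov_program (22, ?m, r @ concat rs @ inp, ?out) (8 * k + 2)
      (30, m1, concat rs @ inp, ?out @ flatten_pairs (bit_edges v 3 r))"
    and m1: "\<forall>r < 7. m1 r = m r"
    using Cons.prems by auto
  let ?m2 = "m1(6 := Suc v)" and ?out2 = "?out @ flatten_pairs (bit_edges v 3 r)"
  have "run w ov_program 2 (30, m1, concat rs @ inp, ?out2) = Some (11, ?m2, concat rs @ inp, ?out2)"
    using Cons.prems m1 by (simp add: run_numeral ov_program_def)
  then have next_row: "reaches w ov_program (30, m1, concat rs @ inp, ?out2) 2
      (11, ?m2, concat rs @ inp, ?out2)"
    by (auto intro: reaches_run)
  have "\<exists>m'. reaches w ov_program (11, ?m2, concat rs @ inp, ?out2) (length rs * (8 * k + 14) + 2)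
      (32, m', inp, ?out2 @ flatten_pairs (row_edges mid (Suc v) rs))"
    using Cons.prems m1 by (intro Cons.IH) auto
  then obtain m' where rest: "reaches w ov_program (11, ?m2, concat rs @ inp, ?out2)
      (length rs * (8 * k + 14) + 2)
      (32, m', inp, ?out2 @ flatten_pairs (row_edges mid (Suc v) rs))"
    by blast
  have "reaches w ov_program (11, m, concat (r # rs) @ inp, out) (10 + (8 * k + 2))
      (30, m1, concat rs @ inp, ?out2)"
    using reaches_trans[OF start bits order_refl] .
  from reaches_trans[OF reaches_trans[OF this next_row order_refl] rest order_refl]
  show ?case by (intro exI[of _ m']) (simp add: algebra_simps)
qed

text \<open>The time adds 11 steps of initialisation, \<open>2 * n\<close> rows and 2 steps for the
  last test. Every number stored is at most the vertex count, which fits into a word by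
  assumption.\<close>

lemma ov_program_computes:
  assumes "length A = n" and "length B = n" and "card C = k" and "3 + k + 2 * n < 2 ^ w"
  shows "\<exists>t \<le> 2 * n * (8 * k + 14) + 13. ram_computes w ov_program (ov_encoding C A B) t
    ((3 + k + length (A @ B)) # 0 # flatten_pairs (ov_edges C A B))"
proof -
  let ?rows = "ov_rows C A B"
  \<comment> \<open>The memory after initialisation; cells 4 and 5, which received \<open>n\<close>
    and \<open>k\<close> from the input, have been overwritten.\<close>
  define m where "m = (\<lambda>_ :: nat. 0 :: nat)(1 := 1, 2 := 2, 3 := 3 + k, 4 := 3 + k + n + n,
    5 := 3 + k + n, 6 := 3 + k)"
  have "run w ov_program 11 (0, \<lambda>_. 0, ov_encoding C A B, []) =
      Some (11, m, concat ?rows @ [], [3 + k + n + n, 0])"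
    using assms
    by (auto simp: run_numeral ov_program_def ov_encoding_def ov_rows_def m_def fun_eq_iff)
  then have init: "reaches w ov_program (0, \<lambda>_. 0, ov_encoding C A B, []) 11
      (11, m, concat ?rows @ [], [3 + k + n + n, 0])"
    by (auto intro: reaches_run)
  have len: "length ?rows = 2 * n"
    using assms by (simp add: ov_rows_def)
  have "\<forall>r \<in> set ?rows. length r = k \<and> (\<forall>b \<in> set r. b < 2 ^ w)"
    using assms by (auto simp: ov_rows_def char_vector_def)
  then have "\<exists>m'. reaches w ov_program (11, m, concat ?rows @ [], [3 + k + n + n, 0])
      (length ?rows * (8 * k + 14) + 2)
      (32, m', [], [3 + k + n + n, 0] @ flatten_pairs (row_edges (3 + k + n) (3 + k) ?rows))"
    using assms len by (intro ov_program_rows) (auto simp: m_def)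
  then obtain m' where rows: "reaches w ov_program (11, m, concat ?rows @ [], [3 + k + n + n, 0])
      (2 * n * (8 * k + 14) + 2)
      (32, m', [], [3 + k + n + n, 0] @ flatten_pairs (ov_edges C A B))"
    using assms(1,3) unfolding len ov_edges_def by blast
  have "reaches w ov_program (0, \<lambda>_. 0, ov_encoding C A B, []) (2 * n * (8 * k + 14) + 13)
      (32, m', [], [3 + k + n + n, 0] @ flatten_pairs (ov_edges C A B))"
    by (rule reaches_trans[OF init rows]) simp
  moreover have "length ov_program = 32" by (simp add: ov_program_def)
  ultimately show ?thesis
    using assms by (auto simp: reaches_def ram_computes_def add.assoc)
qed

section \<open>Resource bounds\<close>

text \<open>Eventually \<open>f n + 1\<close> is at most \<open>(c + 1) * n\<close>, and rounding up
  adds at most 1 to the logarithm.\<close>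

lemma bigo_ln_word_size:
  fixes f :: "nat \<Rightarrow> nat"
  assumes "(\<lambda>n. real (f n)) \<in> O(\<lambda>n. real n)"
  shows "(\<lambda>n. real (nat \<lceil>log 2 (real (f n + 1))\<rceil>)) \<in> O(\<lambda>n. ln (real n))"
proof -
  obtain c where c: "c > 0" "\<forall>\<^sub>F n in at_top. norm (real (f n)) \<le> c * norm (real n)"
    using assms by (auto elim!: landau_o.bigE)
  have "\<forall>\<^sub>F n in at_top. norm (real (nat \<lceil>log 2 (real (f n + 1))\<rceil>))
      \<le> 1 * norm (log 2 ((c + 1) * real n) + 1)"
    using c(2) eventually_gt_at_top[of 0]
  proof eventually_elim
    case (elim n)
    then have "real (f n + 1) \<le> (c + 1) * real n" by (simp add: algebra_simps)
    then have "log 2 (real (f n + 1)) \<le> log 2 ((c + 1) * real n)"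
      by (subst log_le_cancel_iff) auto
    moreover have "0 \<le> log 2 (real (f n + 1))" by simp
    ultimately show ?case unfolding real_norm_def mult_1 by linarith
  qed
  then have "(\<lambda>n. real (nat \<lceil>log 2 (real (f n + 1))\<rceil>)) \<in> O(\<lambda>n. log 2 ((c + 1) * real n) + 1)"
    by (rule landau_o.bigI[rotated]) simp
  also have "(\<lambda>n. log 2 ((c + 1) * real n) + 1) \<in> O(\<lambda>n. ln (real n))"
    using c(1) by real_asymp
  finally show ?thesis .
qed

lemma less_power_word_size: "m < 2 ^ nat \<lceil>log 2 (real (m + 1))\<rceil>"
proof -
  have "real (m + 1) = 2 powr log 2 (real (m + 1))" by simp
  also have "\<dots> \<le> 2 powr real (nat \<lceil>log 2 (real (m + 1))\<rceil>)"
    by (intro powr_mono) linarith+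
  also have "\<dots> = real (2 ^ nat \<lceil>log 2 (real (m + 1))\<rceil>)"
    by (subst powr_realpow) simp_all
  finally show ?thesis by linarith
qed

theorem theorem3:
  "\<exists>P :: program. \<forall>d :: nat \<Rightarrow> nat.
     (\<lambda>n. real (d n)) \<in> O(\<lambda>n. ln (real n)) \<longrightarrow>
     (\<exists>(T :: nat \<Rightarrow> nat) (V :: nat \<Rightarrow> nat) (W :: nat \<Rightarrow> nat).
        (\<lambda>n. real (T n)) \<in> O(\<lambda>n. real n * ln (real n)) \<and>
        (\<lambda>n. real (V n)) \<in> O(\<lambda>n. real n) \<and>
        (\<lambda>n. real (W n)) \<in> O(\<lambda>n. ln (real n)) \<and>
        (\<forall>(n :: nat) (C :: nat set) (A :: nat set list) (B :: nat set list).
           finite C \<and> card C \<le> d n \<and> length A = n \<and> length B = n \<and>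
           (\<forall>a \<in> set A. a \<subseteq> C) \<and> (\<forall>b \<in> set B. b \<subseteq> C) \<longrightarrow>
           (\<exists>(G :: nat pair_pre_digraph) (u :: nat) (t :: nat) (out :: nat list).
              ram_computes (W n) P (ov_encoding C A B) t out \<and> t \<le> T n \<and>
              graph_encoding G u out \<and>
              pair_graph G \<and> u \<in> pverts G \<and> card (pverts G) \<le> V n \<and>
              (\<not> avoidable G u \<longleftrightarrow> (\<exists>a \<in> set A. \<exists>b \<in> set B. a \<inter> b = {})))))"
proof (rule exI[of _ ov_program], intro allI impI, goal_cases)
  case (1 d)
  note d = this
  \<comment> \<open>All bounds depend on \<open>d\<close> alone, with \<open>d n\<close> in place of
    \<open>card C\<close>; \<open>W n\<close> is chosen so that \<open>V n\<close> fits into a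
    word.\<close>
  define T where "T = (\<lambda>n. 2 * n * (8 * d n + 14) + 13)"
  define V where "V = (\<lambda>n. 3 + d n + 2 * n)"
  define W where "W = (\<lambda>n. nat \<lceil>log 2 (real (V n + 1))\<rceil>)"
  have "(\<lambda>n. 8 * real (d n) + 14) \<in> O(\<lambda>n. ln (real n))"
    using d by (intro sum_in_bigo) (simp, real_asymp)
  then have "(\<lambda>n. 2 * real n * (8 * real (d n) + 14)) \<in> O(\<lambda>n. real n * ln (real n))"
    by (intro landau_o.big_mult) simp_all
  then have "(\<lambda>n. 2 * real n * (8 * real (d n) + 14) + 13) \<in> O(\<lambda>n. real n * ln (real n))"
    by (intro sum_in_bigo) (simp, real_asymp)
  then have T: "(\<lambda>n. real (T n)) \<in> O(\<lambda>n. real n * ln (real n))"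
    by (simp add: T_def)
  have "(\<lambda>n. real (d n)) \<in> O(\<lambda>n. real n)"
    using d by (rule landau_o.big_trans) real_asymp
  then have "(\<lambda>n. 3 + real (d n) + 2 * real n) \<in> O(\<lambda>n. real n)"
    by (intro sum_in_bigo) (real_asymp, simp, simp)
  then have V: "(\<lambda>n. real (V n)) \<in> O(\<lambda>n. real n)"
    by (simp add: V_def)
  have W: "(\<lambda>n. real (W n)) \<in> O(\<lambda>n. ln (real n))"
    unfolding W_def using V by (rule bigo_ln_word_size)
  show ?case
  proof (rule exI[of _ T], rule exI[of _ V], rule exI[of _ W], intro conjI T V W allI impI, goal_cases)
    case (1 n C A B)
    then have C: "finite C" "card C \<le> d n" and len: "length A = n" "length B = n"
      and sub: "\<forall>a \<in> set A. a \<subseteq> C" "\<forall>b \<in> set B. b \<subseteq> C"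
      by simp_all
    have "3 + card C + 2 * n \<le> V n" using C by (simp add: V_def)
    also have "\<dots> < 2 ^ W n" unfolding W_def by (rule less_power_word_size)
    finally obtain t where t: "t \<le> 2 * n * (8 * card C + 14) + 13"
      and run: "ram_computes (W n) ov_program (ov_encoding C A B) t
        ((3 + card C + length (A @ B)) # 0 # flatten_pairs (ov_edges C A B))"
      using ov_program_computes[OF len refl] by blast
    have "2 * n * (8 * card C + 14) + 13 \<le> T n"
      unfolding T_def using C(2) by (intro add_mono mult_mono) auto
    with t have t_le: "t \<le> T n" by simp
    have verts: "0 \<in> pverts (ov_graph C A B)" "card (pverts (ov_graph C A B)) \<le> V n"
      using C len by (simp_all add: ov_graph_def V_def)
    have "\<not> avoidable (ov_graph C A B) 0 \<longleftrightarrow> (\<exists>a \<in> set A. \<exists>b \<in> set B. a \<inter> b = {})"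
      using C sub by (intro not_avoidable_ov_graph_iff) auto
    then show ?case
      using run t_le graph_encoding_ov_graph[of C A B] pair_graph_ov_graph[of C A B] verts
      by (intro exI conjI)
  qed
qed

end
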